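(* (Linear independence.) Let $C=C(h)$ be the $2\times2$ matrix with $\begin{pmatrix}\gamma_1(x-h)\\ \gamma_2(x-h)\end{pmatrix}=C\begin{pmatrix}\gamma_1(x)\\ \gamma_2(x)\end{pmatrix}$ for all $x$, and let $\lambda_1$ and $\lambda_2$ be the eigenvalues of $C$. Suppose that $\det C\neq0$ and that if $C$ is diagonalizable then $q=\lambda_1/\lambda_2$ is not a zero of any of the $q$-binomial polynomials $\genfrac{[}{]}{0pt}{}{n}{k}_q$, $k=1,\ldots,n-1$. Then the functions $G_{n,k}$, $k=0,\ldots,n$, are linearly independent.
   Context: Let $n\ge1$ be an integer, $h\in\mathbb R$ fixed, $\gamma_1,\gamma_2:\mathbb R\to\mathbb R$ continuous, linearly independent and translation invariant, meaning that for every $s\in\mathbb R$ there is an invertible $2\times2$ matrix $C(s)$ with $\begin{pmatrix}\gamma_1(x-s)\\ \gamma_2(x-s)\end{pmatrix}=C(s)\begin{pmatrix}\gamma_1(x)\\ \gamma_2(x)\end{pmatrix}$ for all $x$. Eigenvalues and diagonalizability of $C$ are over $\mathbb C$. For $k=0,\ldots,n$, $$G_{n,k}(t)=\sum_{J\subseteq\{0,\ldots,n-1\},\,|J|=k}\ \prod_{j\in J}\gamma_1(t-jh)\prod_{j\in\{0,\ldots,n-1\}\setminus J}\gamma_2(t-jh).$$ The $q$-binomial coefficients (polynomials in $q$) are $\genfrac{[}{]}{0pt}{}{n}{k}_q=\dfrac{(q;q)_n}{(q;q)_k(q;q)_{n-k}}$, where $(a;q)_n=\prod_{j=0}^{n-1}(1-q^ja)$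 for $n\ge1$ and $(a;q)_0=1$. *)

theory Defs
  imports Complex_Main "Jordan_Normal_Form.Spectral_Radius"
begin

definition lin_indep_funs :: "(real \<Rightarrow> real) list \<Rightarrow> bool" where
  "lin_indep_funs fs \<longleftrightarrow>
    (\<forall>c :: nat \<Rightarrow> real. (\<forall>t. (\<Sum>i<length fs. c i * (fs ! i) t) = 0) \<longrightarrow> (\<forall>i<length fs. c i = 0))"

definition translates_by ::
  "(real \<Rightarrow> real) \<Rightarrow> (real \<Rightarrow> real) \<Rightarrow> real \<Rightarrow> real mat \<Rightarrow> bool" where
  "translates_by \<gamma>1 \<gamma>2 s C \<longleftrightarrow> C \<in> carrier_mat 2 2 \<and>
    (\<forall>x. vec_of_list [\<gamma>1 (x - s), \<gamma>2 (x - s)] = C *\<^sub>v vec_of_list [\<gamma>1 x, \<gamma>2 x])"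

definition translation_invariant :: "(real \<Rightarrow> real) \<Rightarrow> (real \<Rightarrow> real) \<Rightarrow> bool" where
  "translation_invariant \<gamma>1 \<gamma>2 \<longleftrightarrow> (\<forall>s. \<exists>C. invertible_mat C \<and> translates_by \<gamma>1 \<gamma>2 s C)"

definition diagonalizable_mat :: "'a :: semiring_1 mat \<Rightarrow> bool" where
  "diagonalizable_mat A \<longleftrightarrow> (\<exists>D. diagonal_mat D \<and> similar_mat A D)"

definition G :: "(real \<Rightarrow> real) \<Rightarrow> (real \<Rightarrow> real) \<Rightarrow> real \<Rightarrow> nat \<Rightarrow> nat \<Rightarrow> real \<Rightarrow> real" where
  "G \<gamma>1 \<gamma>2 h n k t =
    (\<Sum>J | J \<subseteq> {0..<n} \<and> card J = k.
      (\<Prod>j\<in>J. \<gamma>1 (t - real j * h)) * (\<Prod>j\<in>{0..<n} - J. \<gamma>2 (t - real j * h)))"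

definition qpoch :: "'a :: comm_ring_1 \<Rightarrow> 'a \<Rightarrow> nat \<Rightarrow> 'a" where
  "qpoch a q n = (\<Prod>j<n. 1 - q ^ j * a)"

text \<open>The \<open>q\<close>-binomial coefficient is a polynomial in the indeterminate \<open>q = [:0, 1:]\<close>, so that it can
  be evaluated at roots of unity, where the quotient of the evaluated \<open>q\<close>-Pochhammer symbols would
  be \<open>0 / 0\<close>. For \<open>k \<le> n\<close> the polynomial division is exact, see \<open>qbinom_mult\<close>.\<close>

definition qbinom :: "nat \<Rightarrow> nat \<Rightarrow> complex poly" where
  "qbinom n k = (let q = [:0, 1:] in qpoch q q n div (qpoch q q k * qpoch q q (n - k)))"

lemma qpoch_Suc: "qpoch q q (Suc n) = qpoch q q n * (1 - q ^ Suc n)"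
  by (simp add: qpoch_def mult.commute)

lemma qpoch_dvd:
  fixes q :: "'a :: comm_ring_1"
  shows "qpoch q q k * qpoch q q m dvd qpoch q q (k + m)"
proof (induction "k + m" arbitrary: k m)
  case 0
  then show ?case by (simp add: qpoch_def)
next
  case (Suc N)
  show ?case
  proof (cases k; cases m)
    fix i j
    assume k: "k = Suc i" and m: "m = Suc j"
    let ?P = "qpoch q q"
    have N: "N = i + Suc j" "N = Suc i + j"
      using Suc.hyps(2) k m by auto
    have "?P i * ?P (Suc j) dvd ?P N" "?P (Suc i) * ?P j dvd ?P N"
      using Suc.hyps(1)[OF N(1)] Suc.hyps(1)[OF N(2)] N by simp_all
    then have d1: "?P i * ?P (Suc j) * (1 - q ^ Suc i) dvd ?P N * (1 - q ^ Suc i)"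
      and d2: "?P (Suc i) * ?P j * (1 - q ^ Suc j) dvd ?P N * (1 - q ^ Suc j)"
      by (blast intro: mult_dvd_mono dvd_refl)+
    have "?P k * ?P m dvd ?P N * (1 - q ^ Suc i)" "?P k * ?P m dvd ?P N * (1 - q ^ Suc j)"
      using d1 d2 unfolding k m by (simp_all only: qpoch_Suc mult_ac)
    then have "?P k * ?P m dvd ?P N * (1 - q ^ Suc i) + q ^ Suc i * (?P N * (1 - q ^ Suc j))"
      by (rule dvd_add[OF _ dvd_mult])
    also have "\<dots> = ?P N * (1 - q ^ (Suc i + Suc j))"
      by (simp only: power_add algebra_simps mult_1_left mult_1_right)
    also have "\<dots> = ?P (k + m)"
    proof -
      have "k + m = Suc N" "Suc i + Suc j = Suc N" using Suc.hyps(2) k m by auto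
      then show ?thesis by (simp only: qpoch_Suc)
    qed
    finally show ?thesis .
  qed (auto simp: qpoch_def)
qed

lemma qbinom_mult:
  assumes "k \<le> n"
  shows "qbinom n k * (qpoch [:0, 1:] [:0, 1:] k * qpoch [:0, 1:] [:0, 1:] (n - k))
    = qpoch [:0, 1:] [:0, 1:] n"
  using qpoch_dvd[of "[:0, 1:] :: complex poly" k "n - k"] assms
  unfolding qbinom_def Let_def by (simp only: le_add_diff_inverse dvd_div_mult_self)

end

(* The function sum_k c_k G_{n,k}(t) is L(prod_j (gamma_1(t - jh) X + gamma_2(t - jh))), where L is
   the linear functional X^k |-> c_k on polynomials of degree at most n. Let alpha, beta be the
   coordinates of (gamma_1, gamma_2) in a Jordan basis of C, and p_1, p_2 the linear polynomials with
   gamma_1 X + gamma_2 = alpha p_1 + beta p_2; shifting by jh acts on (alpha, beta) by the j-th power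
   of the Jordan form. A nonzero binary form has only finitely many zero directions, while by
   continuity the direction of (alpha, beta), which never vanishes, would be constant if it took
   finitely many values; hence a binary form that vanishes on (alpha, beta) is zero, and we may compare
   coefficients of alpha^k beta^(n-k).
   In the diagonal case the q-binomial theorem gives a nonzero multiple of L(p_1^k p_2^(n-k)) as the
   coefficient. For a Jordan block the coefficients form a triangular system in these numbers. So all
   L(p_1^k p_2^(n-k)) vanish, and therefore L = 0, since X and 1 are combinations of p_1 and p_2. *)

theory Submission
  imports Defs "HOL-Combinatorics.Stirling"
begin

hide_const (open) Module.smult

section \<open>Coefficients of products of linear polynomials\<close>

lemma prod_const_poly: "(\<Prod>j\<in>A. [:b j:]) = [:\<Prod>j\<in>A. b j :: 'a :: comm_ring_1:]"
  by (induction A rule: infinite_finite_induct) (simp_all add: one_pCons)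

text \<open>Expanding the product chooses for each \<open>j\<close> either the \<open>X\<close>-term
  or the constant term, and \<open>J\<close> is the set of indices where the \<open>X\<close>-term
  is taken. With \<open>a j\<close> and \<open>b j\<close> the values of \<open>\<gamma>1\<close>
  and \<open>\<gamma>2\<close> at \<open>t - real j * h\<close>, this is the sum defining
  \<open>G\<close>.\<close>

lemma coeff_prod_linear:
  fixes a b :: "'b \<Rightarrow> 'a :: comm_ring_1"
  assumes "finite A"
  shows "coeff (\<Prod>j\<in>A. [:b j, a j:]) k
    = (\<Sum>J | J \<subseteq> A \<and> card J = k. (\<Prod>j\<in>J. a j) * (\<Prod>j\<in>A - J. b j))"
proof -
  have "(\<Prod>j\<in>A. [:b j, a j:]) = (\<Prod>j\<in>A. monom (a j) 1 + [:b j:])"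
    by (simp add: monom_Suc monom_0)
  also have "\<dots> = (\<Sum>J\<in>Pow A. (\<Prod>j\<in>J. monom (a j) 1) * (\<Prod>j\<in>A - J. [:b j:]))"
    by (rule prod_add[OF assms])
  also have "\<dots> = (\<Sum>J\<in>Pow A. monom ((\<Prod>j\<in>J. a j) * (\<Prod>j\<in>A - J. b j)) (card J))"
  proof (rule sum.cong[OF refl])
    fix J assume "J \<in> Pow A"
    then have fin: "finite J" "finite (A - J)" using assms by (auto intro: finite_subset)
    have "(\<Prod>j\<in>J. monom (a j) 1) = monom (\<Prod>j\<in>J. a j) (card J)"
      using fin(1) by (induction J) (auto simp: mult_monom monom_0 one_pCons)
    moreover have "(\<Prod>j\<in>A - J. [:b j:]) = monom (\<Prod>j\<in>A - J. b j) 0"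
      by (simp add: prod_const_poly monom_0)
    ultimately show "(\<Prod>j\<in>J. monom (a j) 1) * (\<Prod>j\<in>A - J. [:b j:])
      = monom ((\<Prod>j\<in>J. a j) * (\<Prod>j\<in>A - J. b j)) (card J)"
      by (simp add: mult_monom)
  qed
  finally have "coeff (\<Prod>j\<in>A. [:b j, a j:]) k
    = (\<Sum>J\<in>Pow A. if card J = k then (\<Prod>j\<in>J. a j) * (\<Prod>j\<in>A - J. b j) else 0)"
    by (simp add: coeff_sum)
  also have "\<dots> = (\<Sum>J\<in>{J\<in>Pow A. card J = k}. (\<Prod>j\<in>J. a j) * (\<Prod>j\<in>A - J. b j))"
    using assms by (simp add: sum.inter_filter[symmetric] del: Pow_iff)
  finally show ?thesis by (simp add: Pow_def conj_commute)
qed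

section \<open>Expansions of products: q-binomial coefficients and Stirling numbers\<close>

lemma qpoch_indeterminate_neq_0: "qpoch [:0, 1:] [:0, 1:] n \<noteq> (0 :: complex poly)"
proof -
  have "1 - [:0, 1:] ^ j * [:0, 1:] \<noteq> (0 :: complex poly)" for j
  proof
    assume "1 - [:0, 1:] ^ j * [:0, 1:] = (0 :: complex poly)"
    from arg_cong[OF this, of "\<lambda>p. poly p 0"] show False by simp
  qed
  then show ?thesis by (simp add: qpoch_def)
qed

lemma qbinom_0: "qbinom n 0 = 1" and qbinom_self: "qbinom n n = 1"
  using qpoch_indeterminate_neq_0[of n] by (simp_all add: qbinom_def Let_def qpoch_def)

text \<open>Multiplying by a common denominator \<open>?D\<close>, which is nonzero and can be
  cancelled afterwards, reduces the rule to
  \<open>1 - x ^ (a + b) = (1 - x ^ a) + x ^ a * (1 - x ^ b)\<close> with \<open>a = n - k\<close>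
  and \<open>b = Suc k\<close>.\<close>

lemma qbinom_Pascal:
  assumes "k < n"
  shows "qbinom (Suc n) (Suc k) = qbinom n (Suc k) + [:0, 1:] ^ (n - k) * qbinom n k"
proof -
  define x :: "complex poly" where "x = [:0, 1:]"
  let ?P = "qpoch x x"
  have *: "qbinom m i * (?P i * ?P (m - i)) = ?P m" if "i \<le> m" for m i
    using qbinom_mult[OF that] by (simp add: x_def)
  obtain d where d: "n = Suc (k + d)" using less_imp_Suc_add[OF assms] by auto
  let ?D = "?P (Suc k) * ?P (Suc d)"
  have 1: "qbinom (Suc n) (Suc k) * ?D = ?P (Suc n)"
    using *[of "Suc k" "Suc n"] d by simp
  have "qbinom n (Suc k) * ?D = qbinom n (Suc k) * (?P (Suc k) * ?P d) * (1 - x ^ Suc d)"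
    by (simp only: qpoch_Suc[of _ d] mult_ac)
  also have "\<dots> = ?P n * (1 - x ^ Suc d)"
    using *[of "Suc k" n] d by simp
  finally have 2: "qbinom n (Suc k) * ?D = ?P n * (1 - x ^ Suc d)" .
  have "qbinom n k * ?D = qbinom n k * (?P k * ?P (Suc d)) * (1 - x ^ Suc k)"
    by (simp only: qpoch_Suc[of _ k] mult_ac)
  also have "\<dots> = ?P n * (1 - x ^ Suc k)"
    using *[of k n] d by simp
  finally have 3: "qbinom n k * ?D = ?P n * (1 - x ^ Suc k)" .
  have "(qbinom n (Suc k) + x ^ (n - k) * qbinom n k) * ?D
    = qbinom n (Suc k) * ?D + x ^ Suc d * (qbinom n k * ?D)"
    using d by (simp add: algebra_simps)
  also have "\<dots> = ?P n * (1 - x ^ (Suc d + Suc k))"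
    unfolding 2 3 power_add by (simp only: algebra_simps mult_1_left)
  also have "\<dots> = ?P (Suc n)"
    using d by (simp only: qpoch_Suc add_Suc add_Suc_right add.commute)
  finally have "(qbinom n (Suc k) + x ^ (n - k) * qbinom n k) * ?D = qbinom (Suc n) (Suc k) * ?D"
    using 1 by simp
  moreover have "?D \<noteq> 0" using qpoch_indeterminate_neq_0 by (simp add: x_def)
  ultimately show ?thesis by (simp add: x_def)
qed

text \<open>The q-binomial theorem, by splitting off the last factor
  \<open>y + smult (q ^ n) x\<close> and applying the q-Pascal rule. Since the coefficients are
  evaluated polynomials, it holds for every complex \<open>q\<close>, roots of unity
  included.\<close>

lemma q_binomial:
  fixes x y :: "complex poly" and q :: complex
  shows "(\<Prod>j<n. y + smult (q ^ j) x)
    = (\<Sum>k\<le>n. smult (q ^ (k choose 2) * poly (qbinom n k) q) (x ^ k * y ^ (n - k)))"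
proof (induction n)
  case 0
  then show ?case by (simp add: qbinom_0 binomial_eq_0)
next
  case (Suc n)
  define T where "T m k = q ^ (k choose 2) * poly (qbinom m k) q" for m k
  have T0: "T m 0 = 1" for m by (simp add: T_def qbinom_0 binomial_eq_0)
  \<comment> \<open>The top coefficient is separate because the q-Pascal rule is available for
    \<open>k < n\<close> only.\<close>
  have TS: "T (Suc n) (Suc n) = q ^ n * T n n"
    by (simp add: T_def qbinom_self numeral_2_eq_2 power_add)
  have T: "T (Suc n) (Suc k) = T n (Suc k) + q ^ n * T n k" if "k < n" for k
  proof -
    \<comment> \<open>\<open>Suc k choose 2\<close> equals \<open>k + (k choose 2)\<close>, so the
      factor \<open>q ^ (n - k)\<close> of the q-Pascal rule is completed by \<open>q ^ k\<close> to
      \<open>q ^ n\<close>.\<close>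
    have "q ^ (k + (k choose 2)) * q ^ (n - k) = q ^ n * q ^ (k choose 2)"
      using that by (simp add: ac_simps flip: power_add)
    then show ?thesis
      using that by (simp add: T_def qbinom_Pascal numeral_2_eq_2 algebra_simps)
  qed
  have T_sum: "(\<Sum>k<n. smult (T (Suc n) (Suc k)) (x ^ Suc k * y ^ (n - k)))
      = (\<Sum>k<n. smult (T n (Suc k)) (x ^ Suc k * y ^ (n - k)))
        + (\<Sum>k<n. smult (q ^ n * T n k) (x ^ Suc k * y ^ (n - k)))"
    unfolding sum.distrib[symmetric] by (intro sum.cong) (simp_all only: T smult_add_left lessThan_iff)
  have "(\<Prod>j<Suc n. y + smult (q ^ j) x)
    = (\<Sum>k\<le>n. smult (T n k) (x ^ k * y ^ (n - k))) * (y + smult (q ^ n) x)"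
    using Suc by (simp add: T_def mult.commute)
  also have "\<dots> = (\<Sum>k\<le>n. smult (T n k) (x ^ k * y ^ Suc (n - k)))
      + (\<Sum>k\<le>n. smult (q ^ n * T n k) (x ^ Suc k * y ^ (n - k)))"
    by (simp add: algebra_simps sum_distrib_left sum.distrib smult_add_right)
  also have "(\<Sum>k\<le>n. smult (T n k) (x ^ k * y ^ Suc (n - k)))
      = y ^ Suc n + (\<Sum>k<n. smult (T n (Suc k)) (x ^ Suc k * y ^ (n - k)))"
    unfolding sum.atMost_shift
    by (intro arg_cong2[of _ _ _ _ "(+)"] sum.cong) (simp_all add: T0 Suc_diff_Suc del: power_Suc)
  also have "(\<Sum>k\<le>n. smult (q ^ n * T n k) (x ^ Suc k * y ^ (n - k)))
      = (\<Sum>k<n. smult (q ^ n * T n k) (x ^ Suc k * y ^ (n - k)))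
        + smult (T (Suc n) (Suc n)) (x ^ Suc n)"
    by (simp add: TS del: power_Suc flip: lessThan_Suc_atMost)
  also have "y ^ Suc n + (\<Sum>k<n. smult (T n (Suc k)) (x ^ Suc k * y ^ (n - k))) + \<dots>
      = y ^ Suc n + (\<Sum>k<n. smult (T (Suc n) (Suc k)) (x ^ Suc k * y ^ (n - k)))
        + smult (T (Suc n) (Suc n)) (x ^ Suc n)"
    by (simp only: T_sum add.assoc)
  also have "\<dots> = (\<Sum>k\<le>Suc n. smult (T (Suc n) k) (x ^ k * y ^ (Suc n - k)))"
    by (subst sum.atMost_Suc_shift) (simp add: T0 del: power_Suc flip: lessThan_Suc_atMost)
  finally show ?case by (simp add: T_def)
qed

text \<open>The homogenised rising factorial, whose coefficients are the unsigned Stirling numbers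
  of the first kind. It takes the place of the q-binomial theorem when \<open>C\<close> is a Jordan
  block.\<close>

lemma prod_arithmetic_eq_stirling:
  fixes x y :: "complex poly"
  shows "(\<Prod>j<n. y + smult (of_nat j) x)
    = (\<Sum>i\<le>n. smult (of_nat (stirling n i)) (y ^ i * x ^ (n - i)))"
proof (induction n)
  case (Suc n)
  have "(\<Prod>j<Suc n. y + smult (of_nat j) x)
    = (\<Sum>i\<le>n. smult (of_nat (stirling n i)) (y ^ i * x ^ (n - i))) * (y + smult (of_nat n) x)"
    using Suc by (simp add: mult.commute)
  also have "\<dots> = (\<Sum>i\<le>n. smult (of_nat n * of_nat (stirling n i)) (y ^ i * x ^ (Suc n - i)))
      + (\<Sum>i\<le>n. smult (of_nat (stirling n i)) (y ^ Suc i * x ^ (n - i)))"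
    by (simp add: algebra_simps sum_distrib_left Suc_diff_le sum.distrib smult_add_right)
  \<comment> \<open>The added summand \<open>i = Suc n\<close> is zero because
    \<open>stirling n (Suc n) = 0\<close>. The summand \<open>i = 0\<close>, lost in the shift that
    follows, is zero because either \<open>n = 0\<close> or \<open>stirling n 0 = 0\<close>.\<close>
  also have "(\<Sum>i\<le>n. smult (of_nat n * of_nat (stirling n i)) (y ^ i * x ^ (Suc n - i)))
    = (\<Sum>i\<le>Suc n. smult (of_nat n * of_nat (stirling n i)) (y ^ i * x ^ (Suc n - i)))"
    by (simp add: stirling_less)
  also have "\<dots> = (\<Sum>i\<le>n. smult (of_nat n * of_nat (stirling n (Suc i))) (y ^ Suc i * x ^ (n - i)))"
    by (subst sum.atMost_Suc_shift) (cases n; simp del: power_Suc sum.atMost_Suc stirling.simps(4))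
  also have "\<dots> + (\<Sum>i\<le>n. smult (of_nat (stirling n i)) (y ^ Suc i * x ^ (n - i)))
    = (\<Sum>i\<le>n. smult (of_nat (stirling (Suc n) (Suc i))) (y ^ Suc i * x ^ (n - i)))"
    by (simp add: smult_add_left sum.distrib del: power_Suc)
  also have "\<dots> = (\<Sum>i\<le>Suc n. smult (of_nat (stirling (Suc n) i)) (y ^ i * x ^ (Suc n - i)))"
    by (subst sum.atMost_Suc_shift) (simp del: power_Suc stirling.simps(4))
  finally show ?case .
qed simp

section \<open>Binary forms along a curve\<close>

definition homogeneous_independent :: "nat \<Rightarrow> (real \<Rightarrow> complex) \<Rightarrow> (real \<Rightarrow> complex) \<Rightarrow> bool" where
  "homogeneous_independent n \<alpha> \<beta> \<longleftrightarrow>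
    (\<forall>d. (\<forall>t. (\<Sum>k\<le>n. d k * (\<alpha> t ^ k * \<beta> t ^ (n - k))) = 0) \<longrightarrow> (\<forall>k\<le>n. d k = 0))"

lemma homogeneous_independentD:
  assumes "homogeneous_independent n \<alpha> \<beta>"
    and "\<And>t. (\<Sum>k\<le>n. d k * (\<alpha> t ^ k * \<beta> t ^ (n - k))) = 0" and "k \<le> n"
  shows "d k = 0"
  using assms unfolding homogeneous_independent_def by blast

text \<open>The zero directions of a nonzero form split the line into finitely many disjoint closed
  sets; by connectedness one of them is everything, which is a linear relation between
  \<open>\<alpha>\<close> and \<open>\<beta>\<close>. Hence coefficients can be compared as if
  \<open>\<alpha>\<close> and \<open>\<beta>\<close> were indeterminates.\<close>

lemma homogeneous_independent_on_curve:
  fixes \<alpha> \<beta> :: "real \<Rightarrow> complex"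
  assumes cont: "continuous_on UNIV \<alpha>" "continuous_on UNIV \<beta>"
    and no_zero: "\<And>t. \<alpha> t \<noteq> 0 \<or> \<beta> t \<noteq> 0"
    and indep: "\<And>a b. (\<And>t. a * \<alpha> t + b * \<beta> t = 0) \<Longrightarrow> a = 0 \<and> b = 0"
  shows "homogeneous_independent n \<alpha> \<beta>"
  unfolding homogeneous_independent_def
proof (intro allI impI, rule ccontr)
  fix d k
  assume "\<forall>t. (\<Sum>k\<le>n. d k * (\<alpha> t ^ k * \<beta> t ^ (n - k))) = 0" and "k \<le> n" and "d k \<noteq> 0"
  note vanish = this(1)[rule_format]
  \<comment> \<open>The form with \<open>\<beta>\<close> set to 1: its roots are the possible ratios
    \<open>\<alpha> t / \<beta> t\<close>. The direction \<open>\<beta> t = 0\<close> is covered by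
    a separate closed set.\<close>
  define p where "p = (\<Sum>i\<le>n. monom (d i) i)"
  have "coeff p k = d k" using \<open>k \<le> n\<close> by (simp add: p_def coeff_sum)
  with \<open>d k \<noteq> 0\<close> have "p \<noteq> 0" by auto
  then have fin: "finite {z. poly p z = 0}" by (rule poly_roots_finite)
  define F where "F z = {t. \<alpha> t = z * \<beta> t}" for z
  have cl_F: "closed (F z)" for z
    unfolding F_def by (intro closed_Collect_eq continuous_intros cont)
  have cl_0: "closed {t. \<beta> t = 0}"
    by (intro closed_Collect_eq continuous_intros cont)
  have cover: "\<beta> t = 0 \<or> (\<exists>z. poly p z = 0 \<and> t \<in> F z)" for t
  proof (cases "\<beta> t = 0")
    case False
    have "\<beta> t ^ n * poly p (\<alpha> t / \<beta> t) = (\<Sum>i\<le>n. d i * (\<alpha> t ^ i * \<beta> t ^ (n - i)))"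
      unfolding p_def poly_sum poly_monom sum_distrib_left
      using False by (intro sum.cong) (simp_all add: power_divide power_diff)
    with vanish[of t] False have "poly p (\<alpha> t / \<beta> t) = 0" by simp
    moreover have "t \<in> F (\<alpha> t / \<beta> t)" using False by (simp add: F_def)
    ultimately show ?thesis by blast
  qed simp
  have whole: "A = UNIV"
    if "closed A" "closed B" "A \<union> B = UNIV" "A \<inter> B = {}" "A \<noteq> {}" for A B :: "real set"
    using connected_closedD[of UNIV A B] that by auto
  show False
  proof (cases "\<exists>t. \<beta> t = 0")
    case True
    have "closed (\<Union>z\<in>{z. poly p z = 0}. F z)" using fin cl_F by blast
    \<comment> \<open>A point of some \<open>F z\<close> with \<open>\<beta> t = 0\<close> would be
      a common zero of \<open>\<alpha>\<close> and \<open>\<beta>\<close>.\<close>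
    then have "{t. \<beta> t = 0} = UNIV"
      using cover no_zero True by (intro whole[OF cl_0]) (auto simp: F_def)
    then show False using indep[of 0 1] by auto
  next
    case False
    with cover[of 0] obtain z where z: "poly p z = 0" "0 \<in> F z" by blast
    have "closed (\<Union>w\<in>{w. poly p w = 0} - {z}. F w)" using fin cl_F by blast
    \<comment> \<open>Here \<open>\<beta>\<close> has no zeros, so the ratio is determined at each
      point and \<open>F z\<close> is disjoint from the other \<open>F w\<close>.\<close>
    then have "F z = UNIV"
      using cover False z by (intro whole[OF cl_F]) (auto simp: F_def)
    then show False using indep[of 1 "- z"] by (auto simp: F_def)
  qed
qed

section \<open>Jordan forms of two by two matrices\<close>

lemma jordan_nf_2_cases:
  assumes A: "A \<in> carrier_mat 2 2" and nf: "jordan_nf A n_as"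
  obtains a b where "n_as = [(1, a), (1, b)]" | a where "n_as = [(2, a)]"
proof -
  have "similar_mat A (jordan_matrix n_as)" and pos: "0 \<notin> fst ` set n_as"
    using nf by (auto simp: jordan_nf_def)
  from similar_matD[OF this(1)] obtain m
    where "A \<in> carrier_mat m m" "jordan_matrix n_as \<in> carrier_mat m m" by blast
  with A have "dim_row (jordan_matrix n_as) = 2" by (metis carrier_matD(1))
  then have dim: "sum_list (map fst n_as) = 2" by simp
  consider "n_as = []" | n a where "n_as = [(n, a)]"
    | n a m b rest where "n_as = (n, a) # (m, b) # rest"
    by (metis neq_Nil_conv surj_pair)
  then show thesis
  proof cases
    case (3 n a m b rest)
    have "rest = []" using 3 dim pos by (cases rest) auto
    moreover from this have "n = 1" "m = 1" using 3 dim pos by auto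
    ultimately show thesis using that(1) 3 by simp
  qed (use that dim in auto)
qed

text \<open>The similarity is stated as \<open>Q * A = B * Q\<close> because it is then the rule by
  which the coordinates given by \<open>Q\<close> transform. Diagonalizability is recorded in the
  diagonal case, where the hypothesis on the q-binomials has to be invoked.\<close>

lemma jordan_form_2:
  fixes A :: "complex mat"
  assumes A: "A \<in> carrier_mat 2 2" and spec: "spectrum A = {l1, l2}"
  obtains P Q B where "P \<in> carrier_mat 2 2" "Q \<in> carrier_mat 2 2" "P * Q = 1\<^sub>m 2" "Q * P = 1\<^sub>m 2"
    "B \<in> carrier_mat 2 2" "Q * A = B * Q" "B $$ (1, 0) = 0"
    "{B $$ (0, 0), B $$ (1, 1)} = {l1, l2}"
    "B $$ (0, 1) = 0 \<and> diagonalizable_mat A \<or> B $$ (0, 1) = 1 \<and> B $$ (0, 0) = B $$ (1, 1)"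
proof -
  obtain as where "char_poly A = (\<Prod>a\<leftarrow>as. [:- a, 1:])" using char_poly_factorized[OF A] by auto
  then obtain n_as where nf: "jordan_nf A n_as" using jordan_nf_exists[OF A] by blast
  let ?B = "jordan_matrix n_as"
  have sim: "similar_mat A ?B" using nf by (simp add: jordan_nf_def)
  from similar_matD[OF this] obtain m P Q
    where *: "{A, ?B, P, Q} \<subseteq> carrier_mat m m" "P * Q = 1\<^sub>m m" "Q * P = 1\<^sub>m m"
      "A = P * ?B * Q" by blast
  with A have m: "m = 2" by auto
  note * = *[unfolded m]
  then have carr: "P \<in> carrier_mat 2 2" "Q \<in> carrier_mat 2 2" "?B \<in> carrier_mat 2 2" by auto
  have "Q * A = Q * (P * ?B) * Q" 
    unfolding *(4) using carr by (intro assoc_mult_mat[symmetric]) auto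
  also have "Q * (P * ?B) = Q * P * ?B"
    using carr by (intro assoc_mult_mat[symmetric]) auto
  finally have QA: "Q * A = ?B * Q" using *(3) left_mult_one_mat[OF carr(3)] by simp
  have char: "char_poly A = (\<Prod>(n, a)\<leftarrow>n_as. [:- a, 1:] ^ n)"
    using char_poly_similar[OF sim] by (simp add: jordan_matrix_char_poly)
  \<comment> \<open>The spectrum and the diagonal of the Jordan matrix are both the root set of the
    characteristic polynomial, so they agree as sets; the order on the diagonal stays open.\<close>
  have spec': "{l1, l2} = {x. poly (char_poly A) x = 0}"
    unfolding spec[symmetric] spectrum_def using eigenvalue_root_char_poly[OF A] by auto
  from A nf show thesis
  proof (cases rule: jordan_nf_2_cases)
    case (1 a b)
    have B: "?B $$ (0, 0) = a" "?B $$ (1, 1) = b" "?B $$ (0, 1) = 0" "?B $$ (1, 0) = 0"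
      by (simp_all add: 1 jordan_matrix_def Let_def)
    have "poly (char_poly A) x = (x - a) * (x - b)" for x
      unfolding char 1 by (simp add: algebra_simps)
    then have "{a, b} = {x. poly (char_poly A) x = 0}" by auto
    with spec' have "{a, b} = {l1, l2}" by simp
    moreover have "diagonal_mat ?B"
      using carr(3) B by (auto simp: diagonal_mat_def less_2_cases_iff)
    ultimately show thesis
      using that[OF carr(1,2) *(2,3) carr(3) QA] B sim unfolding diagonalizable_mat_def by auto
  next
    case (2 a)
    have B: "?B $$ (0, 0) = a" "?B $$ (1, 1) = a" "?B $$ (0, 1) = 1" "?B $$ (1, 0) = 0"
      by (simp_all add: 2 jordan_matrix_def Let_def)
    have "{a, a} = {x. poly (char_poly A) x = 0}" unfolding char 2 by auto
    with spec' have "{a, a} = {l1, l2}" by (simp only:)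
    then show thesis
      using that[OF carr(1,2) *(2,3) carr(3) QA] B by auto
  qed
qed

section \<open>Linear functionals vanishing on products of linear polynomials\<close>

lemma binomial_smult:
  fixes p q :: "complex poly"
  shows "(smult a p + smult b q) ^ m
    = (\<Sum>i\<le>m. smult (of_nat (m choose i) * (a ^ i * b ^ (m - i))) (p ^ i * q ^ (m - i)))"
proof -
  have "of_nat k * r = smult (of_nat k) r" for k and r :: "complex poly"
    by (simp add: of_nat_poly)
  then show ?thesis
    by (simp add: binomial_ring smult_power mult.assoc) (simp add: mult_ac)
qed

locale complex_poly_functional =
  fixes L :: "complex poly \<Rightarrow> complex"
  assumes add: "L (p + q) = L p + L q" and smult: "L (smult a p) = a * L p"
begin

lemma zero: "L 0 = 0"
  using smult[of 0 0] by simp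

lemma sum: "L (\<Sum>i\<in>I. f i) = (\<Sum>i\<in>I. L (f i))"
  by (induction I rule: infinite_finite_induct) (simp_all add: zero add)

text \<open>Binomial expansion of \<open>u ^ k\<close> and \<open>v ^ (n - k)\<close> leaves only
  products of \<open>n\<close> factors \<open>p1\<close> or \<open>p2\<close>. Applied to
  \<open>u = X\<close> and \<open>v = 1\<close>, it gives the values of \<open>L\<close> on the
  powers of \<open>X\<close>.\<close>

lemma vanish_change_basis:
  assumes p: "\<And>i. i \<le> n \<Longrightarrow> L (p1 ^ i * p2 ^ (n - i)) = 0"
    and u: "u = smult a p1 + smult b p2" and v: "v = smult c p1 + smult d p2" and k: "k \<le> n"
  shows "L (u ^ k * v ^ (n - k)) = 0"
proof -
  have "L ((p1 ^ i * p2 ^ (k - i)) * (p1 ^ j * p2 ^ (n - k - j))) = 0"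
    if "i \<le> k" "j \<le> n - k" for i j
  proof -
    have "(p1 ^ i * p2 ^ (k - i)) * (p1 ^ j * p2 ^ (n - k - j))
      = p1 ^ (i + j) * (p2 ^ (k - i) * p2 ^ (n - k - j))"
      by (simp add: power_add mult_ac)
    also have "p2 ^ (k - i) * p2 ^ (n - k - j) = p2 ^ (n - (i + j))"
      using that k by (simp flip: power_add)
    finally show ?thesis using that k p[of "i + j"] by simp
  qed
  then show ?thesis
    unfolding u v binomial_smult sum_product sum
    by (intro sum.neutral ballI) (simp add: smult)
qed

lemma vanish_diagonal:
  assumes hom: "homogeneous_independent n \<alpha> \<beta>"
    and vanish: "\<And>t. L (\<Prod>j<n. smult (l1 ^ j * \<alpha> t) p1 + smult (l2 ^ j * \<beta> t) p2) = 0"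
    and nz: "l1 \<noteq> 0" "l2 \<noteq> 0" and qb: "poly (qbinom n k) (l1 / l2) \<noteq> 0" and k: "k \<le> n"
  shows "L (p1 ^ k * p2 ^ (n - k)) = 0"
proof -
  let ?q = "l1 / l2"
  let ?c = "\<lambda>k. ?q ^ (k choose 2) * poly (qbinom n k) ?q"
  have "?c k * L (p1 ^ k * p2 ^ (n - k)) = 0"
  proof (rule homogeneous_independentD[OF hom _ k])
    fix t
    \<comment> \<open>Taking the nonzero factor \<open>l2 ^ j\<close> out of the \<open>j\<close>-th
      factor leaves the powers of \<open>?q\<close> that the q-binomial theorem requires.\<close>
    have "(\<Prod>j<n. smult (l1 ^ j * \<alpha> t) p1 + smult (l2 ^ j * \<beta> t) p2)
      = (\<Prod>j<n. smult (l2 ^ j) (smult (\<beta> t) p2 + smult (?q ^ j) (smult (\<alpha> t) p1)))"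
      using nz by (intro prod.cong) (simp_all add: smult_add_right power_divide add.commute)
    also have "\<dots> = smult (\<Prod>j<n. l2 ^ j)
      (\<Prod>j<n. smult (\<beta> t) p2 + smult (?q ^ j) (smult (\<alpha> t) p1))"
      by (rule prod_smult)
    finally have "L (\<Prod>j<n. smult (\<beta> t) p2 + smult (?q ^ j) (smult (\<alpha> t) p1)) = 0"
      using vanish[of t] nz by (simp add: smult)
    then show "(\<Sum>k\<le>n. ?c k * L (p1 ^ k * p2 ^ (n - k)) * (\<alpha> t ^ k * \<beta> t ^ (n - k))) = 0"
      unfolding q_binomial sum by (simp add: smult smult_power mult_ac)
  qed
  then show ?thesis using nz qb by simp
qed

text \<open>Up to the factor \<open>l ^ j\<close>, the \<open>j\<close>-th factor is
  \<open>y + j x\<close> with \<open>y = \<alpha> p1 + \<beta> p2\<close> and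
  \<open>x = \<mu> \<beta> p1\<close>, so the Stirling expansion applies.\<close>

lemma vanish_jordan:
  assumes hom: "homogeneous_independent n \<alpha> \<beta>"
    and vanish: "\<And>t. L (\<Prod>j<n. smult (l ^ j * (\<alpha> t + of_nat j * \<mu> * \<beta> t)) p1
      + smult (l ^ j * \<beta> t) p2) = 0"
    and nz: "l \<noteq> 0" and k: "k \<le> n"
  shows "L (p1 ^ k * p2 ^ (n - k)) = 0"
proof -
  define M where "M k = L (p1 ^ k * p2 ^ (n - k))" for k
  define f :: "nat \<Rightarrow> complex" where "f i = of_nat (stirling n i)" for i
  then have fn: "f n = 1" by simp
  \<comment> \<open>The coefficient of \<open>\<alpha> t ^ m * \<beta> t ^ (n - m)\<close>: the term
    \<open>y ^ i * x ^ (n - i)\<close> supplies \<open>m\<close> factors \<open>p1\<close> from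
    \<open>y\<close> and \<open>n - i\<close> more from \<open>x\<close>. For \<open>i < m\<close>
    the index \<open>n - i + m\<close> exceeds \<open>n\<close>, but the binomial coefficient is
    0.\<close>
  define d where "d m = (\<Sum>i\<le>n. f i * of_nat (i choose m) * \<mu> ^ (n - i) * M (n - i + m))" for m
  have d0: "d m = 0" if "m \<le> n" for m
  proof (rule homogeneous_independentD[OF hom _ that])
    fix t
    let ?y = "smult (\<alpha> t) p1 + smult (\<beta> t) p2" and ?x = "smult (\<mu> * \<beta> t) p1"
    have "(\<Prod>j<n. smult (l ^ j * (\<alpha> t + of_nat j * \<mu> * \<beta> t)) p1 + smult (l ^ j * \<beta> t) p2)
      = (\<Prod>j<n. smult (l ^ j) (?y + smult (of_nat j) ?x))"
      by (intro prod.cong) (simp_all add: smult_add_right smult_add_left algebra_simps)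
    also have "\<dots> = smult (\<Prod>j<n. l ^ j) (\<Prod>j<n. ?y + smult (of_nat j) ?x)"
      by (rule prod_smult)
    finally have "0 = L (\<Prod>j<n. ?y + smult (of_nat j) ?x)"
      using vanish[of t] nz by (simp add: smult)
    also have "\<dots> = (\<Sum>i\<le>n. f i * L (?y ^ i * ?x ^ (n - i)))"
      unfolding prod_arithmetic_eq_stirling sum by (simp add: smult f_def)
    also have "\<dots> = (\<Sum>i\<le>n. \<Sum>m\<le>n. f i * of_nat (i choose m) * \<mu> ^ (n - i) * M (n - i + m)
        * (\<alpha> t ^ m * \<beta> t ^ (n - m)))"
    proof (rule sum.cong[OF refl])
      fix i assume "i \<in> {..n}"
      then have i: "i \<le> n" by simp
      have "f i * L (?y ^ i * ?x ^ (n - i)) = (\<Sum>m\<le>i. f i * of_nat (i choose m) * \<mu> ^ (n - i)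
          * M (n - i + m) * (\<alpha> t ^ m * \<beta> t ^ (n - m)))"
        unfolding binomial_smult sum_distrib_right sum sum_distrib_left
      proof (rule sum.cong[OF refl])
        fix m assume "m \<in> {..i}"
        then have m: "m \<le> i" by simp
        have "n - (n - i + m) = i - m" using i m by simp
        then have p: "p1 ^ m * p2 ^ (i - m) * p1 ^ (n - i) = p1 ^ (n - i + m) * p2 ^ (n - (n - i + m))"
          by (simp only: power_add mult_ac)
        have \<beta>: "\<beta> t ^ (n - m) = \<beta> t ^ (i - m) * \<beta> t ^ (n - i)"
          using i m by (simp flip: power_add)
        have "smult (of_nat (i choose m) * (\<alpha> t ^ m * \<beta> t ^ (i - m))) (p1 ^ m * p2 ^ (i - m)) * ?x ^ (n - i)
          = smult (of_nat (i choose m) * (\<alpha> t ^ m * \<beta> t ^ (i - m)) * (\<mu> * \<beta> t) ^ (n - i))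
              (p1 ^ m * p2 ^ (i - m) * p1 ^ (n - i))"
          by (simp add: smult_power mult_ac)
        then show "f i * L (smult (of_nat (i choose m) * (\<alpha> t ^ m * \<beta> t ^ (i - m)))
            (p1 ^ m * p2 ^ (i - m)) * ?x ^ (n - i))
          = f i * of_nat (i choose m) * \<mu> ^ (n - i) * M (n - i + m) * (\<alpha> t ^ m * \<beta> t ^ (n - m))"
          unfolding p by (simp add: smult M_def \<beta> power_mult_distrib mult_ac)
      qed
      also have "\<dots> = (\<Sum>m\<le>n. f i * of_nat (i choose m) * \<mu> ^ (n - i)
          * M (n - i + m) * (\<alpha> t ^ m * \<beta> t ^ (n - m)))"
        using i by (intro sum.mono_neutral_left) (auto simp: binomial_eq_0)
      finally show "f i * L (?y ^ i * ?x ^ (n - i)) = \<dots>" .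
    qed
    also have "\<dots> = (\<Sum>m\<le>n. d m * (\<alpha> t ^ m * \<beta> t ^ (n - m)))"
      unfolding d_def sum_distrib_right by (rule sum.swap)
    finally show "(\<Sum>m\<le>n. d m * (\<alpha> t ^ m * \<beta> t ^ (n - m))) = 0" by simp
  qed
  \<comment> \<open>Descending induction on \<open>k\<close>. In \<open>d k = 0\<close> the summand
    \<open>i = n\<close> is \<open>(n choose k) * M k\<close>, since
    \<open>stirling n n = 1\<close>; every summand with \<open>i < n\<close> either has binomial
    coefficient 0 or contains some \<open>M\<close> of larger index.\<close>
  have "M k = 0" using k
  proof (induction "n - k" arbitrary: k rule: less_induct)
    case less
    have *: "f i * of_nat (i choose k) * \<mu> ^ (n - i) * M (n - i + k) = 0" if "i < n" for i
    proof (cases "i < k")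
      case False
      then have "M (n - i + k) = 0" using that less.prems by (intro less.hyps) auto
      then show ?thesis by simp
    qed (simp add: binomial_eq_0)
    have "(\<Sum>i<n. f i * of_nat (i choose k) * \<mu> ^ (n - i) * M (n - i + k)) = 0"
      by (intro sum.neutral ballI *) simp
    then have "d k = of_nat (n choose k) * M k"
      unfolding d_def lessThan_Suc_atMost[symmetric] sum.lessThan_Suc by (simp only: fn) simp
    then show ?case using d0[OF less.prems] less.prems by simp
  qed
  then show ?thesis by (simp add: M_def)
qed

end

section \<open>Translations in coordinates\<close>

lemma index_mult_mat_2:
  assumes "A \<in> carrier_mat 2 2" "B \<in> carrier_mat 2 2" "i < 2" "j < 2"
  shows "(A * B) $$ (i, j) = A $$ (i, 0) * B $$ (0, j) + A $$ (i, 1) * B $$ (1, j)"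
  using assms by (simp add: scalar_prod_def numeral_2_eq_2)

lemma translates_byD:
  assumes "translates_by \<gamma>1 \<gamma>2 s D"
  shows "\<gamma>1 (x - s) = D $$ (0, 0) * \<gamma>1 x + D $$ (0, 1) * \<gamma>2 x"
    and "\<gamma>2 (x - s) = D $$ (1, 0) * \<gamma>1 x + D $$ (1, 1) * \<gamma>2 x"
proof -
  have D: "D \<in> carrier_mat 2 2"
    and eq: "vec_of_list [\<gamma>1 (x - s), \<gamma>2 (x - s)] = D *\<^sub>v vec_of_list [\<gamma>1 x, \<gamma>2 x]"
    using assms by (auto simp: translates_by_def)
  show "\<gamma>1 (x - s) = D $$ (0, 0) * \<gamma>1 x + D $$ (0, 1) * \<gamma>2 x"
    using D arg_cong[OF eq, of "\<lambda>v. v $ 0"]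
    by (simp add: scalar_prod_def numeral_2_eq_2 vec_of_list_index)
  show "\<gamma>2 (x - s) = D $$ (1, 0) * \<gamma>1 x + D $$ (1, 1) * \<gamma>2 x"
    using D arg_cong[OF eq, of "\<lambda>v. v $ 1"]
    by (simp add: scalar_prod_def numeral_2_eq_2 vec_of_list_index)
qed

lemma lin_indep_funs_pairD:
  assumes "lin_indep_funs [f, g]" and fg: "\<And>t. a * f t + b * g t = 0"
  shows "a = 0 \<and> b = 0"
proof -
  have "\<forall>t. (\<Sum>i<length [f, g]. (if i = 0 then a else b) * ([f, g] ! i) t) = 0"
    using fg by (simp add: lessThan_Suc add.commute)
  with assms(1)[unfolded lin_indep_funs_def, THEN spec, of "\<lambda>i. if i = 0 then a else b"]
  have *: "\<forall>i<length [f, g]. (if i = 0 then a else b) = 0" by blast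
  show ?thesis using *[rule_format, of 0] *[rule_format, of 1] by simp
qed

text \<open>The translation by \<open>t - x\<close> expresses the values at \<open>x\<close>
  linearly through those at \<open>t\<close>, so a common zero at \<open>t\<close> would spread to
  every \<open>x\<close>.\<close>

lemma translation_invariant_no_common_zero:
  assumes "translation_invariant \<gamma>1 \<gamma>2" and "lin_indep_funs [\<gamma>1, \<gamma>2]"
  shows "\<gamma>1 t \<noteq> 0 \<or> \<gamma>2 t \<noteq> 0"
proof (rule ccontr)
  assume z: "\<not> (\<gamma>1 t \<noteq> 0 \<or> \<gamma>2 t \<noteq> 0)"
  have "\<gamma>1 x = 0" for x
  proof -
    obtain D where "translates_by \<gamma>1 \<gamma>2 (t - x) D"
      using assms(1) unfolding translation_invariant_def by blast
    from translates_byD(1)[OF this, of t] z show ?thesis by simp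
  qed
  then show False using lin_indep_funs_pairD[OF assms(2), of 1 0] by simp
qed

section \<open>Linear independence of the functions \<open>G\<close>\<close>

theorem propositionA:
  fixes n :: nat and h :: real and \<gamma>1 \<gamma>2 :: "real \<Rightarrow> real"
    and C :: "real mat" and lam1 lam2 :: complex
  assumes "n \<ge> 1"
    and "continuous_on UNIV \<gamma>1" and "continuous_on UNIV \<gamma>2"
    and "lin_indep_funs [\<gamma>1, \<gamma>2]"
    and "translation_invariant \<gamma>1 \<gamma>2"
    and "translates_by \<gamma>1 \<gamma>2 h C"
    and "spectrum (map_mat complex_of_real C) = {lam1, lam2}"
    and "det C \<noteq> 0"
    and "diagonalizable_mat (map_mat complex_of_real C) \<longrightarrow>
      (\<forall>k\<in>{1..n - 1}. poly (qbinom n k) (lam1 / lam2) \<noteq> 0)"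
  shows "lin_indep_funs (map (G \<gamma>1 \<gamma>2 h n) [0..<Suc n])"
  unfolding lin_indep_funs_def
proof (intro allI impI)
  fix c :: "nat \<Rightarrow> real" and m
  assume "\<forall>t. (\<Sum>i<length (map (G \<gamma>1 \<gamma>2 h n) [0..<Suc n]). c i * (map (G \<gamma>1 \<gamma>2 h n) [0..<Suc n] ! i) t) = 0"
  then have relation: "(\<Sum>i\<le>n. c i * G \<gamma>1 \<gamma>2 h n i t) = 0" for t
    by (simp del: upt_Suc add: lessThan_Suc_atMost nth_append)
  assume "m < length (map (G \<gamma>1 \<gamma>2 h n) [0..<Suc n])"
  then have "m \<le> n" by simp
  let ?A = "map_mat complex_of_real C"
  have C: "C \<in> carrier_mat 2 2" using assms(6) by (simp add: translates_by_def)
  then have A: "?A \<in> carrier_mat 2 2" by simp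
  note indep = lin_indep_funs_pairD[OF assms(4)]
  note no_zero = translation_invariant_no_common_zero[OF assms(5,4)]
  obtain P Q B where PQ: "P \<in> carrier_mat 2 2" "Q \<in> carrier_mat 2 2" "P * Q = 1\<^sub>m 2" "Q * P = 1\<^sub>m 2"
    and B: "B \<in> carrier_mat 2 2" "Q * ?A = B * Q" "B $$ (1, 0) = 0"
      "{B $$ (0, 0), B $$ (1, 1)} = {lam1, lam2}"
      "B $$ (0, 1) = 0 \<and> diagonalizable_mat ?A \<or> B $$ (0, 1) = 1 \<and> B $$ (0, 0) = B $$ (1, 1)"
    by (rule jordan_form_2[OF A assms(7)])
  have PQ_entries: "P $$ (0, 0) * Q $$ (0, 0) + P $$ (0, 1) * Q $$ (1, 0) = 1"
    "P $$ (0, 0) * Q $$ (0, 1) + P $$ (0, 1) * Q $$ (1, 1) = 0"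
    "P $$ (1, 0) * Q $$ (0, 0) + P $$ (1, 1) * Q $$ (1, 0) = 0"
    "P $$ (1, 0) * Q $$ (0, 1) + P $$ (1, 1) * Q $$ (1, 1) = 1"
    using index_mult_mat_2[OF PQ(1,2), of 0 0] index_mult_mat_2[OF PQ(1,2), of 0 1]
      index_mult_mat_2[OF PQ(1,2), of 1 0] index_mult_mat_2[OF PQ(1,2), of 1 1] PQ(3) by simp_all
  have QP_entries: "Q $$ (0, 0) * P $$ (0, 0) + Q $$ (0, 1) * P $$ (1, 0) = 1"
    "Q $$ (0, 0) * P $$ (0, 1) + Q $$ (0, 1) * P $$ (1, 1) = 0"
    "Q $$ (1, 0) * P $$ (0, 0) + Q $$ (1, 1) * P $$ (1, 0) = 0"
    "Q $$ (1, 0) * P $$ (0, 1) + Q $$ (1, 1) * P $$ (1, 1) = 1"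
    using index_mult_mat_2[OF PQ(2,1), of 0 0] index_mult_mat_2[OF PQ(2,1), of 0 1]
      index_mult_mat_2[OF PQ(2,1), of 1 0] index_mult_mat_2[OF PQ(2,1), of 1 1] PQ(4) by simp_all
  have QA: "Q $$ (i, 0) * C $$ (0, j) + Q $$ (i, 1) * C $$ (1, j)
      = B $$ (i, 0) * Q $$ (0, j) + B $$ (i, 1) * Q $$ (1, j)" if "i < 2" "j < 2" for i j
    using index_mult_mat_2[OF PQ(2) A that] index_mult_mat_2[OF B(1) PQ(2) that] B(2) C that by simp
  define \<alpha> where "\<alpha> t = Q $$ (0, 0) * \<gamma>1 t + Q $$ (0, 1) * \<gamma>2 t" for t
  define \<beta> where "\<beta> t = Q $$ (1, 0) * \<gamma>1 t + Q $$ (1, 1) * \<gamma>2 t" for t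
  have \<gamma>: "complex_of_real (\<gamma>1 t) = P $$ (0, 0) * \<alpha> t + P $$ (0, 1) * \<beta> t"
    "complex_of_real (\<gamma>2 t) = P $$ (1, 0) * \<alpha> t + P $$ (1, 1) * \<beta> t" for t
  proof -
    have "P $$ (i, 0) * \<alpha> t + P $$ (i, 1) * \<beta> t
      = (P $$ (i, 0) * Q $$ (0, 0) + P $$ (i, 1) * Q $$ (1, 0)) * \<gamma>1 t
        + (P $$ (i, 0) * Q $$ (0, 1) + P $$ (i, 1) * Q $$ (1, 1)) * \<gamma>2 t" for i
      by (simp add: \<alpha>_def \<beta>_def algebra_simps)
    then show "complex_of_real (\<gamma>1 t) = P $$ (0, 0) * \<alpha> t + P $$ (0, 1) * \<beta> t"
      "complex_of_real (\<gamma>2 t) = P $$ (1, 0) * \<alpha> t + P $$ (1, 1) * \<beta> t"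
      by (simp_all only: PQ_entries) simp_all
  qed
  \<comment> \<open>\<open>Q * C = B * Q\<close> turns the shift by \<open>h\<close> into the action
    of the upper triangular \<open>B\<close> on \<open>(\<alpha>, \<beta>)\<close>.\<close>
  have step: "\<alpha> (t - h) = B $$ (0, 0) * \<alpha> t + B $$ (0, 1) * \<beta> t" "\<beta> (t - h) = B $$ (1, 1) * \<beta> t" for t
  proof -
    have *: "Q $$ (i, 0) * \<gamma>1 (t - h) + Q $$ (i, 1) * \<gamma>2 (t - h)
      = B $$ (i, 0) * \<alpha> t + B $$ (i, 1) * \<beta> t" if "i < 2" for i
    proof -
      have "Q $$ (i, 0) * \<gamma>1 (t - h) + Q $$ (i, 1) * \<gamma>2 (t - h)
        = (Q $$ (i, 0) * C $$ (0, 0) + Q $$ (i, 1) * C $$ (1, 0)) * \<gamma>1 t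
          + (Q $$ (i, 0) * C $$ (0, 1) + Q $$ (i, 1) * C $$ (1, 1)) * \<gamma>2 t"
        using translates_byD[OF assms(6), of t] by (simp add: algebra_simps)
      also have "\<dots> = B $$ (i, 0) * \<alpha> t + B $$ (i, 1) * \<beta> t"
        using QA[OF that, of 0] QA[OF that, of 1]
        by (simp only: pos2 one_less_numeral_iff semiring_norm)
          (simp add: \<alpha>_def \<beta>_def algebra_simps)
      finally show ?thesis .
    qed
    from *[of 0] *[of 1] show "\<alpha> (t - h) = B $$ (0, 0) * \<alpha> t + B $$ (0, 1) * \<beta> t"
      "\<beta> (t - h) = B $$ (1, 1) * \<beta> t"
      using B(3) by (simp_all add: \<alpha>_def \<beta>_def)
  qed
  have nz: "B $$ (0, 0) \<noteq> 0" "B $$ (1, 1) \<noteq> 0"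
  proof -
    have "det Q * det ?A = det B * det Q"
      by (simp only: B(2) det_mult[OF PQ(2) A, symmetric] det_mult[OF B(1) PQ(2), symmetric])
    moreover have "det ?A \<noteq> 0" using assms(8) by simp
    moreover have "det P * det Q = 1"
      using det_mult[OF PQ(1,2)] PQ(3) by simp
    ultimately have "det B \<noteq> 0" by auto
    moreover have "upper_triangular B"
      using B(1,3) by (auto simp: less_2_cases_iff)
    ultimately have "B $$ (0, 0) * B $$ (1, 1) \<noteq> 0"
      using det_upper_triangular[of B 2] B(1) by (simp add: diag_mat_def numeral_2_eq_2)
    then show "B $$ (0, 0) \<noteq> 0" "B $$ (1, 1) \<noteq> 0" by auto
  qed
  have cont: "continuous_on UNIV \<alpha>" "continuous_on UNIV \<beta>"
    unfolding \<alpha>_def \<beta>_def by (intro continuous_intros assms(2,3))+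
  have no_zero': "\<alpha> t \<noteq> 0 \<or> \<beta> t \<noteq> 0" for t
    using no_zero[of t] \<gamma>[of t] by auto
  \<comment> \<open>The row \<open>(u, v)\<close> is \<open>(a, b)\<close> times \<open>Q\<close>.
    As \<open>\<gamma>1\<close> and \<open>\<gamma>2\<close> are real, the real and imaginary parts
    of \<open>u\<close> and \<open>v\<close> give two real relations; multiplying by
    \<open>P\<close> then returns to \<open>(a, b)\<close>.\<close>
  have indep': "a = 0 \<and> b = 0" if ab: "\<And>t. a * \<alpha> t + b * \<beta> t = 0" for a b
  proof -
    define u v where "u = a * Q $$ (0, 0) + b * Q $$ (1, 0)" and "v = a * Q $$ (0, 1) + b * Q $$ (1, 1)"
    have uv: "u * \<gamma>1 t + v * \<gamma>2 t = 0" for t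
      using ab[of t] by (simp add: u_def v_def \<alpha>_def \<beta>_def algebra_simps)
    have "Re u = 0 \<and> Re v = 0"
      using arg_cong[OF uv, of Re] by (intro indep) simp
    moreover have "Im u = 0 \<and> Im v = 0"
      using arg_cong[OF uv, of Im] by (intro indep) simp
    ultimately have "u = 0" "v = 0" by (simp_all add: complex_eq_iff)
    moreover have "u * P $$ (0, i) + v * P $$ (1, i)
      = a * (Q $$ (0, 0) * P $$ (0, i) + Q $$ (0, 1) * P $$ (1, i))
        + b * (Q $$ (1, 0) * P $$ (0, i) + Q $$ (1, 1) * P $$ (1, i))" for i
      by (simp add: u_def v_def algebra_simps)
    from this[of 0] this[of 1] have "u * P $$ (0, 0) + v * P $$ (1, 0) = a"
      "u * P $$ (0, 1) + v * P $$ (1, 1) = b"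
      by (simp_all only: QP_entries) simp_all
    ultimately show ?thesis by simp
  qed
  have hom: "homogeneous_independent n \<alpha> \<beta>"
    by (rule homogeneous_independent_on_curve[OF cont no_zero' indep'])
  have "a = 0 \<and> b = 0" if "\<And>t. a * \<beta> t + b * \<alpha> t = 0" for a b
    using indep'[of b a] that by (simp add: add.commute)
  with no_zero' have hom_swap: "homogeneous_independent n \<beta> \<alpha>"
    by (intro homogeneous_independent_on_curve cont(2,1)) blast+
  define L where "L p = (\<Sum>k\<le>n. complex_of_real (c k) * coeff p k)" for p
  interpret complex_poly_functional L
    by standard (simp_all add: L_def algebra_simps sum.distrib sum_distrib_left)
  \<comment> \<open>The columns of \<open>P\<close> read as linear polynomials, so that
    \<open>\<gamma>1 X + \<gamma>2 = \<alpha> p1 + \<beta> p2\<close>. \<open>P * Q = 1\<close> then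
    recovers \<open>X\<close> and 1 from them.\<close>
  define p1 p2 where "p1 = [:P $$ (1, 0), P $$ (0, 0):]" and "p2 = [:P $$ (1, 1), P $$ (0, 1):]"
  have basis: "[:0, 1:] = smult (Q $$ (0, 0)) p1 + smult (Q $$ (1, 0)) p2"
    "1 = smult (Q $$ (0, 1)) p1 + smult (Q $$ (1, 1)) p2"
    using PQ_entries by (simp_all add: p1_def p2_def one_pCons mult.commute)
  have vanish: "L (\<Prod>j<n. smult (\<alpha> (t - real j * h)) p1 + smult (\<beta> (t - real j * h)) p2) = 0" for t
  proof -
    have "(\<Prod>j<n. smult (\<alpha> (t - real j * h)) p1 + smult (\<beta> (t - real j * h)) p2)
      = (\<Prod>j\<in>{0..<n}. [:complex_of_real (\<gamma>2 (t - real j * h)), complex_of_real (\<gamma>1 (t - real j * h)):])"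
      by (intro prod.cong) (auto simp: p1_def p2_def \<gamma> mult.commute)
    then have "L (\<Prod>j<n. smult (\<alpha> (t - real j * h)) p1 + smult (\<beta> (t - real j * h)) p2)
      = complex_of_real (\<Sum>k\<le>n. c k * G \<gamma>1 \<gamma>2 h n k t)"
      by (simp add: L_def coeff_prod_linear G_def)
    then show ?thesis by (simp add: relation)
  qed
  have \<beta>_shift: "\<beta> (t - real j * h) = B $$ (1, 1) ^ j * \<beta> t" for t j
  proof (induction j)
    case (Suc j)
    then show ?case using step(2)[of "t - real j * h"] by (simp add: algebra_simps)
  qed simp
  have "(\<forall>k\<le>n. L (p1 ^ k * p2 ^ (n - k)) = 0) \<or> (\<forall>k\<le>n. L (p2 ^ k * p1 ^ (n - k)) = 0)"
    using B(5)
  proof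
    assume diag: "B $$ (0, 1) = 0 \<and> diagonalizable_mat ?A"
    have \<alpha>_shift: "\<alpha> (t - real j * h) = B $$ (0, 0) ^ j * \<alpha> t" for t j
    proof (induction j)
      case (Suc j)
      then show ?case using step(1)[of "t - real j * h"] diag by (simp add: algebra_simps)
    qed simp
    \<comment> \<open>The hypothesis covers \<open>1\<close> to \<open>n - 1\<close>; at both ends
      the q-binomial is 1.\<close>
    have qb: "poly (qbinom n k) (lam1 / lam2) \<noteq> 0" if "k \<le> n" for k
    proof (cases "k = 0 \<or> k = n")
      case True
      then show ?thesis by (auto simp: qbinom_0 qbinom_self)
    next
      case False
      then have "k \<in> {1..n - 1}" using that by auto
      then show ?thesis using assms(9) diag by blast
    qed
    \<comment> \<open>The diagonal may carry the eigenvalues in either order, while the hypothesis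
      concerns \<open>lam1 / lam2\<close> only. In the second order \<open>\<alpha>, p1\<close> and
      \<open>\<beta>, p2\<close> exchange roles, hence \<open>hom_swap\<close>.\<close>
    consider "B $$ (0, 0) = lam1" "B $$ (1, 1) = lam2" | "B $$ (0, 0) = lam2" "B $$ (1, 1) = lam1"
      using B(4) unfolding doubleton_eq_iff by blast
    then show ?thesis
    proof cases
      case 1
      have *: "L (\<Prod>j<n. smult (lam1 ^ j * \<alpha> t) p1 + smult (lam2 ^ j * \<beta> t) p2) = 0" for t
        using vanish[of t] by (simp only: \<alpha>_shift \<beta>_shift 1)
      have "L (p1 ^ k * p2 ^ (n - k)) = 0" if "k \<le> n" for k
        by (rule vanish_diagonal[OF hom * _ _ qb[OF that] that]) (use nz 1 in simp_all)
      then show ?thesis by blast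
    next
      case 2
      have "L (\<Prod>j<n. smult (\<beta> (t - real j * h)) p2 + smult (\<alpha> (t - real j * h)) p1) = 0" for t
        using vanish[of t] by (simp only: add.commute)
      then have *: "L (\<Prod>j<n. smult (lam1 ^ j * \<beta> t) p2 + smult (lam2 ^ j * \<alpha> t) p1) = 0" for t
        by (simp only: \<alpha>_shift \<beta>_shift 2)
      have "L (p2 ^ k * p1 ^ (n - k)) = 0" if "k \<le> n" for k
        by (rule vanish_diagonal[OF hom_swap * _ _ qb[OF that] that]) (use nz 2 in simp_all)
      then show ?thesis by blast
    qed
  next
    assume jordan: "B $$ (0, 1) = 1 \<and> B $$ (0, 0) = B $$ (1, 1)"
    \<comment> \<open>The \<open>j\<close>-th power of a Jordan block with eigenvalue
      \<open>l\<close> has corner entry \<open>j * l ^ (j - 1)\<close>; written as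
      \<open>l ^ j * j * (1 / l)\<close> it fits \<open>vanish_jordan\<close> with
      \<open>\<mu> = 1 / l\<close>.\<close>
    have \<alpha>_shift: "\<alpha> (t - real j * h) = B $$ (1, 1) ^ j * (\<alpha> t + of_nat j * (1 / B $$ (1, 1)) * \<beta> t)" for t j
    proof (induction j)
      case (Suc j)
      have "\<alpha> (t - real (Suc j) * h) = B $$ (1, 1) * \<alpha> (t - real j * h) + \<beta> (t - real j * h)"
        using step(1)[of "t - real j * h"] jordan by (simp add: algebra_simps)
      also have "\<dots> = B $$ (1, 1) * (B $$ (1, 1) ^ j * (\<alpha> t + of_nat j * (1 / B $$ (1, 1)) * \<beta> t))
          + B $$ (1, 1) ^ j * \<beta> t"
        by (simp only: Suc \<beta>_shift)
      also have "\<dots> = B $$ (1, 1) ^ Suc j * (\<alpha> t + of_nat (Suc j) * (1 / B $$ (1, 1)) * \<beta> t)"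
        using nz(2) by (simp add: field_simps)
      finally show ?case .
    qed simp
    have "L (p1 ^ k * p2 ^ (n - k)) = 0" if "k \<le> n" for k
      by (rule vanish_jordan[OF hom vanish[unfolded \<alpha>_shift \<beta>_shift] nz(2) that])
    then show ?thesis by blast
  qed
  then have "L ([:0, 1:] ^ m * 1 ^ (n - m)) = 0"
  proof
    assume "\<forall>k\<le>n. L (p1 ^ k * p2 ^ (n - k)) = 0"
    then show ?thesis by (intro vanish_change_basis[OF _ basis \<open>m \<le> n\<close>]) simp
  next
    assume "\<forall>k\<le>n. L (p2 ^ k * p1 ^ (n - k)) = 0"
    then show ?thesis
      by (intro vanish_change_basis[OF _ basis[THEN trans, OF add.commute] \<open>m \<le> n\<close>]) simp
  qed
  \<comment> \<open>\<open>L\<close> reads off the coefficient \<open>c m\<close> because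
    \<open>m \<le> n\<close>.\<close>
  moreover have "L ([:0, 1:] ^ m * 1 ^ (n - m)) = complex_of_real (c m)"
    using \<open>m \<le> n\<close>
    by (simp add: L_def monom_altdef[of 1 m, simplified, symmetric] if_distrib cong: if_cong)
  ultimately show "c m = 0" by simp
qed

end
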